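(* For each proper $\delta$-model $\mathcal{M}=(W,\sim,V)$ there exists a simplicial model $\mathcal{C}=(\mathbb{C},L)$ that is a $\delta$-translation of $\mathcal{M}$.
   Context: Fix a finite set $\mathsf{Ag}$ of agents; an agent pattern is a set $G\subseteq\mathcal{P}(\mathsf{Ag})\setminus\{\emptyset\}$; $\mathsf{Prop}$ is a countable set of atoms. Let $\mathsf{Ag}_{si}=\{(A,i)\mid A\subseteq\mathsf{Ag},\ i\in\mathbb{N}\}$; $(A,i)\in S$ is maximal in $S$ if $|A|\ge|B|$ for all $(B,j)\in S$. A nonempty $S\subseteq\mathsf{Ag}_{si}$ is a simplex if (S1) it has a unique maximal element $\max(S)$; (S2) for every $(B,i)\in S$ and $C\subseteq B$ there is exactly one $j$ with $(C,j)\in S$; (S3) if $(B,i)\in S$ and $(A,j)=\max(S)$ then $B\subseteq A$. A set $\mathbb{C}$ of simplices is a complex if for all $S,T\in\mathbb{C}$: if $(A,i)\in S\cap T$ then for all $B\subseteq A$ and $j$, $(B,j)\in S$ iff $(B,j)\in T$. $S^\circ=\{A\mid\exists i\,(A,i)\in S\}$. A simplicial model is $(\mathbb{C},L)$ with $\mathbb{C}$ a complex and $L:\mathbb{C}\to\mathcal{P}(\mathsf{Prop})$. A pre-model $\mathcal{M}=(W,\sim,V)$: $W$ a set, $\sim_G$ a symmetric transitive relation on $W$ for each agent pattern $G$, $V:W\to\mathcal{P}(\mathsf{Prop})$. $\mathsf{alive}(G)_\mathcal{M}=\{w\mid w\sim_G w\}$. A $\delta$-model is a pre-model with, for all agent patterns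 $G,H$: (K2) $\mathsf{alive}(G)_\mathcal{M}\subseteq\mathsf{alive}(\{A\cup B\})_\mathcal{M}$ for $A,B\in G$; (K3) $\sim_H\subseteq\sim_G$ if $G\subseteq H$; (K4) $\sim_G\subseteq\sim_{G\cup\{B\}}$ if some $A\in G$ has $\emptyset\ne B\subseteq A$; (NE) every $w$ has some $G$ with $w\sim_G w$; (D) $\sim_G=\bigcap_{B\in G}\sim_{\{B\}}$. For $w\in W$ let $\overline{w}=\{B\mid\exists G.\ B\in G\text{ and }w\in\mathsf{alive}(G)_\mathcal{M}\}$; $w\equiv v$ iff $\overline{w}=\overline{v}$ and $w\sim_{\overline{w}}v$; $\mathcal{M}$ is proper iff $w\equiv v$ implies $w=v$. A simplicial model $\mathcal{C}=(\mathbb{C},L)$ is a $\delta$-translation of a $\delta$-model $\mathcal{M}=(W,\sim,V)$ if there is a mapping $T:W\to\mathbb{C}$ such that for all $w,v\in W$, all agent patterns $G$ and all $p\in\mathsf{Prop}$: (1) $G\subseteq(T(w)\cap T(v))^\circ$ iff $w\sim_G v$; (2) $p\in L(T(w))$ iff $p\in V(w)$.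
   Formalization: The set W of worlds is assumed countable: with Ag finite and indices in ℕ there are only countably many simplices and a δ-translation of a proper model is injective, so the claim fails for every uncountable proper δ-model. *)

theory Defs
  imports Main "HOL-Library.Countable_Set" "HOL-Library.FuncSet"
begin

section \<open>Simplicial models\<close>

definition agent_pattern :: "'a set \<Rightarrow> 'a set set \<Rightarrow> bool" where
  "agent_pattern Ag G \<longleftrightarrow> G \<subseteq> Pow Ag - {{}}"

definition Ag_si :: "'a set \<Rightarrow> ('a set \<times> nat) set" where
  "Ag_si Ag = {(A, i). A \<subseteq> Ag}"

definition maximal_in :: "('a set \<times> nat) set \<Rightarrow> 'a set \<times> nat \<Rightarrow> bool" where
  "maximal_in S x \<longleftrightarrow> x \<in> S \<and> (\<forall>(B, j) \<in> S. card B \<le> card (fst x))"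

definition max_elem :: "('a set \<times> nat) set \<Rightarrow> 'a set \<times> nat" where
  "max_elem S = (THE x. maximal_in S x)"

definition is_simplex :: "'a set \<Rightarrow> ('a set \<times> nat) set \<Rightarrow> bool" where
  "is_simplex Ag S \<longleftrightarrow>
     S \<noteq> {} \<and> S \<subseteq> Ag_si Ag \<and>
     (\<exists>!x. maximal_in S x) \<and>
     (\<forall>(B, i) \<in> S. \<forall>C \<subseteq> B. \<exists>!j. (C, j) \<in> S) \<and>
     (\<forall>(B, i) \<in> S. B \<subseteq> fst (max_elem S))"

definition is_complex :: "'a set \<Rightarrow> ('a set \<times> nat) set set \<Rightarrow> bool" where
  "is_complex Ag \<C> \<longleftrightarrow>
     (\<forall>S \<in> \<C>. is_simplex Ag S) \<and>
     (\<forall>S \<in> \<C>. \<forall>T \<in> \<C>. \<forall>(A, i) \<in> S \<inter> T. \<forall>B \<subseteq> A. \<forall>j. (B, j) \<in> S \<longleftrightarrow> (B, j) \<in> T)"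

definition degr :: "('a set \<times> nat) set \<Rightarrow> 'a set set" where
  "degr S = {A. \<exists>i. (A, i) \<in> S}"

definition simplicial_model ::
  "'a set \<Rightarrow> 'p set \<Rightarrow> ('a set \<times> nat) set set \<Rightarrow> (('a set \<times> nat) set \<Rightarrow> 'p set) \<Rightarrow> bool" where
  "simplicial_model Ag Atoms \<C> L \<longleftrightarrow> is_complex Ag \<C> \<and> L \<in> \<C> \<rightarrow> Pow Atoms"


section \<open>\<open>\<delta>\<close>-models\<close>

text \<open>The relation \<open>\<sim>\<^sub>G\<close> is \<open>R G\<close>; its values at sets \<open>G\<close> that are not agent patterns are irrelevant.\<close>

definition pre_model ::
  "'a set \<Rightarrow> 'p set \<Rightarrow> 'w set \<Rightarrow> ('a set set \<Rightarrow> ('w \<times> 'w) set) \<Rightarrow> ('w \<Rightarrow> 'p set) \<Rightarrow> bool" where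
  "pre_model Ag Atoms W R V \<longleftrightarrow>
     (\<forall>G. agent_pattern Ag G \<longrightarrow> R G \<subseteq> W \<times> W \<and> sym (R G) \<and> trans (R G)) \<and>
     V \<in> W \<rightarrow> Pow Atoms"

definition alive :: "'w set \<Rightarrow> ('a set set \<Rightarrow> ('w \<times> 'w) set) \<Rightarrow> 'a set set \<Rightarrow> 'w set" where
  "alive W R G = {w \<in> W. (w, w) \<in> R G}"

text \<open>In the last condition, (D), the intersection is taken among relations on \<open>W\<close>, so that it is
  \<open>W \<times> W\<close> for the empty agent pattern.\<close>

definition delta_model ::
  "'a set \<Rightarrow> 'p set \<Rightarrow> 'w set \<Rightarrow> ('a set set \<Rightarrow> ('w \<times> 'w) set) \<Rightarrow> ('w \<Rightarrow> 'p set) \<Rightarrow> bool" where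
  "delta_model Ag Atoms W R V \<longleftrightarrow>
     pre_model Ag Atoms W R V \<and>
     (\<forall>G A B. agent_pattern Ag G \<and> A \<in> G \<and> B \<in> G \<longrightarrow> alive W R G \<subseteq> alive W R {A \<union> B}) \<and>
     (\<forall>G H. agent_pattern Ag G \<and> agent_pattern Ag H \<and> G \<subseteq> H \<longrightarrow> R H \<subseteq> R G) \<and>
     (\<forall>G B. agent_pattern Ag G \<and> (\<exists>A \<in> G. B \<noteq> {} \<and> B \<subseteq> A) \<longrightarrow> R G \<subseteq> R (G \<union> {B})) \<and>
     (\<forall>w \<in> W. \<exists>G. agent_pattern Ag G \<and> (w, w) \<in> R G) \<and>
     (\<forall>G. agent_pattern Ag G \<longrightarrow> R G = (W \<times> W) \<inter> (\<Inter>B \<in> G. R {B}))"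

definition world_pattern ::
  "'a set \<Rightarrow> 'w set \<Rightarrow> ('a set set \<Rightarrow> ('w \<times> 'w) set) \<Rightarrow> 'w \<Rightarrow> 'a set set" where
  "world_pattern Ag W R w = {B. \<exists>G. agent_pattern Ag G \<and> B \<in> G \<and> w \<in> alive W R G}"

definition world_equiv ::
  "'a set \<Rightarrow> 'w set \<Rightarrow> ('a set set \<Rightarrow> ('w \<times> 'w) set) \<Rightarrow> 'w \<Rightarrow> 'w \<Rightarrow> bool" where
  "world_equiv Ag W R w v \<longleftrightarrow>
     world_pattern Ag W R w = world_pattern Ag W R v \<and> (w, v) \<in> R (world_pattern Ag W R w)"

definition proper :: "'a set \<Rightarrow> 'w set \<Rightarrow> ('a set set \<Rightarrow> ('w \<times> 'w) set) \<Rightarrow> bool" where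
  "proper Ag W R \<longleftrightarrow> (\<forall>w \<in> W. \<forall>v \<in> W. world_equiv Ag W R w v \<longrightarrow> w = v)"

definition delta_translation ::
  "'a set \<Rightarrow> 'p set \<Rightarrow> ('a set \<times> nat) set set \<Rightarrow> (('a set \<times> nat) set \<Rightarrow> 'p set) \<Rightarrow>
   'w set \<Rightarrow> ('a set set \<Rightarrow> ('w \<times> 'w) set) \<Rightarrow> ('w \<Rightarrow> 'p set) \<Rightarrow> bool" where
  "delta_translation Ag Atoms \<C> L W R V \<longleftrightarrow>
     (\<exists>T \<in> W \<rightarrow> \<C>.
        (\<forall>w \<in> W. \<forall>v \<in> W. \<forall>G. agent_pattern Ag G \<longrightarrow> (G \<subseteq> degr (T w \<inter> T v) \<longleftrightarrow> (w, v) \<in> R G)) \<and>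
        (\<forall>w \<in> W. \<forall>p \<in> Atoms. p \<in> L (T w) \<longleftrightarrow> p \<in> V w))"


section \<open>Only countable models can be translated\<close>

text \<open>Over a finite set of agents there are only countably many simplices, because vertices are
  indexed by natural numbers, and a translation of a proper model is injective. So a proper
  \<open>\<delta>\<close>-model with a translation has a countable set of worlds, whereas proper \<open>\<delta>\<close>-models exist on
  every set of worlds.\<close>

lemma countable_simplices:
  assumes "finite Ag"
  shows "countable {S. is_simplex Ag S}"
proof -
  have "finite S \<and> S \<subseteq> Pow Ag \<times> (UNIV :: nat set)" if S: "is_simplex Ag S" for S
  proof -
    have sub: "S \<subseteq> Pow Ag \<times> UNIV"
      using S by (auto simp: is_simplex_def Ag_si_def)
    have "inj_on fst S"
    proof (rule inj_onI)
      fix x y assume "x \<in> S" "y \<in> S" "fst x = fst y"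
      moreover obtain B i j where "x = (B, i)" "y = (B, j)"
        using \<open>fst x = fst y\<close> by (metis prod.collapse)
      moreover have "\<exists>!j. (B, j) \<in> S"
        using S \<open>x \<in> S\<close> \<open>x = (B, i)\<close> unfolding is_simplex_def by fast
      ultimately show "x = y" by blast
    qed
    moreover have "finite (fst ` S)"
      using finite_subset[OF image_mono[OF sub, of fst]] assms by simp
    ultimately have "finite S" by (rule finite_imageD[rotated])
    with sub show ?thesis by blast
  qed
  then have "{S. is_simplex Ag S} \<subseteq> {S. finite S \<and> S \<subseteq> Pow Ag \<times> (UNIV :: nat set)}" by blast
  moreover have "countable {S. finite S \<and> S \<subseteq> Pow Ag \<times> (UNIV :: nat set)}"
    using assms by (intro countable_Collect_finite_subset countable_SIGMA) (auto simp: countable_finite)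
  ultimately show ?thesis by (rule countable_subset)
qed

lemma delta_translation_imp_countable:
  assumes "finite Ag" and "proper Ag W R"
    and "simplicial_model Ag Atoms \<C> L" and "delta_translation Ag Atoms \<C> L W R V"
  shows "countable W"
proof -
  obtain T where T: "T \<in> W \<rightarrow> \<C>"
    and T_iff: "\<forall>w \<in> W. \<forall>v \<in> W. \<forall>G. agent_pattern Ag G \<longrightarrow>
                  (G \<subseteq> degr (T w \<inter> T v) \<longleftrightarrow> (w, v) \<in> R G)"
    using assms(4) unfolding delta_translation_def by (elim bexE conjE)
  have iff: "G \<subseteq> degr (T w \<inter> T v) \<longleftrightarrow> (w, v) \<in> R G"
    if "w \<in> W" "v \<in> W" "agent_pattern Ag G" for w v G
    using T_iff that by simp
  have "inj_on T W"
  proof (rule inj_onI)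
    fix w v assume wv: "w \<in> W" "v \<in> W" and eq: "T w = T v"
    let ?P = "world_pattern Ag W R w"
    have same: "(w, w) \<in> R G \<longleftrightarrow> (v, v) \<in> R G" if "agent_pattern Ag G" for G
      using iff[OF wv(1) wv(1) that] iff[OF wv(2) wv(2) that] eq by simp
    have "?P = world_pattern Ag W R v"
      unfolding world_pattern_def alive_def using wv by (simp add: same cong: conj_cong)
    moreover have "(w, v) \<in> R ?P"
    proof -
      have pat: "agent_pattern Ag ?P"
        unfolding world_pattern_def agent_pattern_def by blast
      have "?P \<subseteq> degr (T w \<inter> T v)"
      proof
        fix B assume "B \<in> ?P"
        then obtain G where "agent_pattern Ag G" "B \<in> G" "(w, w) \<in> R G"
          unfolding world_pattern_def alive_def by blast
        then show "B \<in> degr (T w \<inter> T v)"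
          using iff[OF wv(1) wv(1), of G] unfolding eq by blast
      qed
      then show ?thesis using iff[OF wv pat] by simp
    qed
    ultimately show "w = v"
      using assms(2) wv by (simp add: proper_def world_equiv_def)
  qed
  moreover have "T ` W \<subseteq> {S. is_simplex Ag S}"
    using T assms(3) unfolding simplicial_model_def is_complex_def by auto
  then have "countable (T ` W)"
    using countable_simplices[OF assms(1)] countable_subset by blast
  ultimately show ?thesis by (rule countable_image_inj_on[rotated])
qed

lemma proper_delta_model_exists:
  fixes Ag :: "'a set" and W :: "'w set"
  assumes "Ag \<noteq> {}"
  defines "R \<equiv> \<lambda>G :: 'a set set. if G = {} then W \<times> W else Id_on W"
  shows "delta_model Ag Atoms W R (\<lambda>_. {})" and "proper Ag W R"
proof -
  have R_empty: "R {} = W \<times> W" and R_nonempty: "\<And>G. G \<noteq> {} \<Longrightarrow> R G = Id_on W"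
    by (simp_all add: R_def)
  have R_bounds: "Id_on W \<subseteq> R G" "R G \<subseteq> W \<times> W" for G
    by (cases "G = {}"; auto simp: R_empty R_nonempty)+
  have alive: "alive W R G = W" for G
    using R_bounds(1)[of G] by (auto simp: alive_def)
  have pre: "pre_model Ag Atoms W R (\<lambda>_. {})"
  proof -
    have "sym (R G) \<and> trans (R G)" for G
      by (cases "G = {}") (auto simp: R_empty R_nonempty sym_def trans_def)
    then show ?thesis using R_bounds(2) by (simp add: pre_model_def)
  qed
  have K3: "R H \<subseteq> R G" if "G \<subseteq> H" for G H
  proof (cases "G = {}")
    case True
    then show ?thesis using R_bounds(2) by (simp add: R_empty)
  next
    case False
    then have "H \<noteq> {}" using that by blast
    with False show ?thesis by (simp add: R_nonempty)
  qed
  have K4: "R G \<subseteq> R (G \<union> {B})" if "\<exists>A \<in> G. B \<noteq> {} \<and> B \<subseteq> A" for G B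
  proof -
    have "G \<noteq> {}" using that by blast
    then show ?thesis by (simp add: R_nonempty)
  qed
  have NE: "\<exists>G. agent_pattern Ag G \<and> (w, w) \<in> R G" if "w \<in> W" for w
    using that by (intro exI[of _ "{}"]) (simp add: R_empty agent_pattern_def)
  have D: "R G = (W \<times> W) \<inter> (\<Inter>B \<in> G. R {B})" for G
    by (cases "G = {}") (auto simp: R_empty R_nonempty)
  show "delta_model Ag Atoms W R (\<lambda>_. {})"
    unfolding delta_model_def alive
    by (intro conjI allI impI ballI; (elim conjE)?; (rule pre subset_refl K3 K4 NE D; assumption?))
  have "agent_pattern Ag {Ag}"
    using assms(1) by (simp add: agent_pattern_def)
  then have "Ag \<in> world_pattern Ag W R w" if "w \<in> W" for w
    using that unfolding world_pattern_def alive by blast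
  then have "R (world_pattern Ag W R w) = Id_on W" if "w \<in> W" for w
    using that by (intro R_nonempty) blast
  then show "proper Ag W R"
    unfolding proper_def world_equiv_def by (simp add: Id_on_iff)
qed

end

theory Submission
  imports Defs
begin

text \<open>A world \<open>w\<close> is sent to the set of all pairs \<open>(B, i)\<close>, where \<open>B\<close> is empty or alive in \<open>w\<close> and
  \<open>i\<close> is a number for the \<open>\<sim>\<^bsub>{B}\<^esub>\<close>-class of \<open>w\<close>. By (D), (K2) and (K4) the sets alive in \<open>w\<close> are closed
  under unions and nonempty subsets, so this is a simplex whose maximal face is the union of all of
  them. Two such simplices share a vertex over \<open>B \<noteq> {}\<close> exactly if the worlds are related by \<open>\<sim>\<^bsub>{B}\<^esub>\<close>,
  and by (D) these relations determine all the others. If the simplices of \<open>w\<close> and \<open>v\<close> coincide,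
  then \<open>w \<equiv> v\<close>; hence properness makes the map injective and the labelling well defined.\<close>

section \<open>Simplices from families closed under subsets and unions\<close>

lemma finite_Union_mem:
  assumes "finite F" "F \<subseteq> \<F>" "{} \<in> \<F>" "\<And>A B. A \<in> \<F> \<Longrightarrow> B \<in> \<F> \<Longrightarrow> A \<union> B \<in> \<F>"
  shows "\<Union>F \<in> \<F>"
  using assms(1,2)
proof (induction F rule: finite_induct)
  case empty
  show ?case using assms(3) by simp
next
  case (insert A F)
  then show ?case using assms(4)[of A "\<Union>F"] by simp
qed

text \<open>A graph has exactly one index over each set of the family, which together with
  \<open>down\<close> gives (S2). By \<open>un\<close> the union of the finite family is itself a
  member; it contains all the others and so is the only one of largest cardinality.\<close>

lemma is_simplex_graph:
  fixes \<F> :: "'a set set" and c :: "'a set \<Rightarrow> nat"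
  assumes "finite Ag" "\<F> \<subseteq> Pow Ag" "{} \<in> \<F>"
    and down: "\<And>A B. A \<in> \<F> \<Longrightarrow> B \<subseteq> A \<Longrightarrow> B \<in> \<F>"
    and un: "\<And>A B. A \<in> \<F> \<Longrightarrow> B \<in> \<F> \<Longrightarrow> A \<union> B \<in> \<F>"
  shows "is_simplex Ag ((\<lambda>B. (B, c B)) ` \<F>)" (is "is_simplex Ag ?S")
proof -
  let ?M = "\<Union>\<F>"
  have "finite \<F>" using assms(1,2) by (meson finite_Pow_iff finite_subset)
  then have M: "?M \<in> \<F>" using assms(3) un by (intro finite_Union_mem) auto
  then have fin: "finite ?M" using assms(1,2) by (meson PowD finite_subset subsetD)
  have maxM: "maximal_in ?S (?M, c ?M)"
    using M fin by (auto simp: maximal_in_def intro!: card_mono)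
  have uniq: "x = (?M, c ?M)" if x: "maximal_in ?S x" for x
  proof -
    obtain B where B: "B \<in> \<F>" "x = (B, c B)"
      using x unfolding maximal_in_def by blast
    have "card ?M \<le> card B"
      using x M B by (auto simp: maximal_in_def)
    with B fin have "B = ?M" by (intro card_seteq) auto
    with B show ?thesis by simp
  qed
  have "max_elem ?S = (?M, c ?M)"
    unfolding max_elem_def using maxM uniq by (rule the_equality)
  moreover have "\<exists>!x. maximal_in ?S x" using maxM uniq by blast
  moreover have "\<exists>!j. (C, j) \<in> ?S" if "B \<in> \<F>" "C \<subseteq> B" for B C
    using down[OF that] by auto
  ultimately show ?thesis
    unfolding is_simplex_def using assms(2,3) by (auto simp: Ag_si_def)
qed

section \<open>Closure properties of the sets alive in a world\<close>

locale delta =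
  fixes Ag :: "'a set" and Atoms :: "'p set" and W :: "'w set"
    and R :: "'a set set \<Rightarrow> ('w \<times> 'w) set" and V :: "'w \<Rightarrow> 'p set"
  assumes delta_model: "delta_model Ag Atoms W R V"
begin

lemma
  assumes "agent_pattern Ag G"
  shows R_sub: "R G \<subseteq> W \<times> W" and R_sym: "sym (R G)" and R_trans: "trans (R G)"
proof -
  have "\<forall>G. agent_pattern Ag G \<longrightarrow> R G \<subseteq> W \<times> W \<and> sym (R G) \<and> trans (R G)"
    using delta_model unfolding delta_model_def pre_model_def by (elim conjE)
  with assms show "R G \<subseteq> W \<times> W" "sym (R G)" "trans (R G)" by simp_all
qed

lemma alive_Un:
  assumes "agent_pattern Ag G" "A \<in> G" "B \<in> G"
  shows "alive W R G \<subseteq> alive W R {A \<union> B}"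
  using delta_model assms unfolding delta_model_def by simp

lemma R_antimono:
  assumes "agent_pattern Ag G" "agent_pattern Ag H" "G \<subseteq> H"
  shows "R H \<subseteq> R G"
proof -
  have "\<forall>G H. agent_pattern Ag G \<and> agent_pattern Ag H \<and> G \<subseteq> H \<longrightarrow> R H \<subseteq> R G"
    using delta_model unfolding delta_model_def by (elim conjE)
  with assms show ?thesis by blast
qed

lemma R_insert_subface:
  assumes "agent_pattern Ag G" "A \<in> G" "B \<noteq> {}" "B \<subseteq> A"
  shows "R G \<subseteq> R (G \<union> {B})"
proof -
  have "\<forall>G B. agent_pattern Ag G \<and> (\<exists>A \<in> G. B \<noteq> {} \<and> B \<subseteq> A) \<longrightarrow> R G \<subseteq> R (G \<union> {B})"
    using delta_model unfolding delta_model_def by (elim conjE)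
  with assms show ?thesis by blast
qed

lemma R_iff:
  assumes "agent_pattern Ag G" "w \<in> W" "v \<in> W"
  shows "(w, v) \<in> R G \<longleftrightarrow> (\<forall>B \<in> G. (w, v) \<in> R {B})"
proof -
  have "R G = (W \<times> W) \<inter> (\<Inter>B \<in> G. R {B})"
    using delta_model assms(1) unfolding delta_model_def by simp
  with assms show ?thesis by blast
qed

text \<open>(K4) adjoins \<open>B\<close> to the pattern \<open>{A}\<close> without losing pairs,
  and (K3) then drops \<open>A\<close>.\<close>

lemma R_singleton_mono:
  assumes "A \<subseteq> Ag" "B \<subseteq> A" "B \<noteq> {}"
  shows "R {A} \<subseteq> R {B}"
proof -
  have "agent_pattern Ag {A}" "agent_pattern Ag {B}" "agent_pattern Ag ({A} \<union> {B})"
    using assms by (auto simp: agent_pattern_def)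
  then have "R {A} \<subseteq> R ({A} \<union> {B})" "R ({A} \<union> {B}) \<subseteq> R {B}"
    using R_insert_subface[of "{A}" A B] R_antimono[of "{B}" "{A} \<union> {B}"] assms by auto
  then show ?thesis by (rule subset_trans)
qed

text \<open>By (D), a pattern alive at \<open>w\<close> has all its singletons alive at
  \<open>w\<close>, so world patterns can be studied through the relations
  \<open>R {B}\<close>.\<close>

lemma world_pattern_eq:
  assumes "w \<in> W"
  shows "world_pattern Ag W R w = {B. B \<subseteq> Ag \<and> B \<noteq> {} \<and> (w, w) \<in> R {B}}" (is "?P = ?Q")
proof (intro equalityI subsetI)
  fix B assume "B \<in> ?P"
  then obtain G where G: "agent_pattern Ag G" "B \<in> G" "(w, w) \<in> R G"
    unfolding world_pattern_def alive_def by blast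
  then show "B \<in> ?Q" using R_iff[OF G(1) assms assms] by (auto simp: agent_pattern_def)
next
  fix B assume "B \<in> ?Q"
  then show "B \<in> ?P"
    using assms unfolding world_pattern_def alive_def
    by (auto intro!: exI[of _ "{B}"] simp: agent_pattern_def)
qed

lemma agent_pattern_world_pattern: "agent_pattern Ag (world_pattern Ag W R w)"
  unfolding world_pattern_def agent_pattern_def by blast

lemma world_pattern_down:
  assumes "w \<in> W" "A \<in> world_pattern Ag W R w" "B \<subseteq> A" "B \<noteq> {}"
  shows "B \<in> world_pattern Ag W R w"
  using assms R_singleton_mono[of A B] by (auto simp: world_pattern_eq)

text \<open>(D) makes the pattern \<open>{A, B}\<close> alive at \<open>w\<close>, and to this
  pattern (K2) applies.\<close>

lemma world_pattern_Un:
  assumes "w \<in> W" "A \<in> world_pattern Ag W R w" "B \<in> world_pattern Ag W R w"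
  shows "A \<union> B \<in> world_pattern Ag W R w"
proof -
  have G: "agent_pattern Ag {A, B}"
    using assms by (auto simp: world_pattern_eq agent_pattern_def)
  then have "w \<in> alive W R {A, B}"
    using assms by (auto simp: R_iff[OF G] alive_def world_pattern_eq)
  moreover have "alive W R {A, B} \<subseteq> alive W R {A \<union> B}"
    using alive_Un[OF G] by simp
  ultimately show ?thesis
    using assms by (auto simp: alive_def world_pattern_eq)
qed

section \<open>The simplex of a world\<close>

text \<open>Agent patterns never contain the empty set, but (S2) demands a vertex over it.\<close>

definition faces :: "'w \<Rightarrow> 'a set set" where
  "faces w = insert {} (world_pattern Ag W R w)"

text \<open>Over the empty set all simplices share the vertex \<open>({}, 0)\<close>: every face contains it, and
  \<open>R {{}}\<close> is unspecified.\<close>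

definition class_code :: "'w \<Rightarrow> 'a set \<Rightarrow> nat" where
  "class_code w B = (if B = {} then 0 else to_nat_on W (SOME u. u \<in> R {B} `` {w}))"

definition simplex_of :: "'w \<Rightarrow> ('a set \<times> nat) set" where
  "simplex_of w = (\<lambda>B. (B, class_code w B)) ` faces w"

lemma mem_simplex_of: "(B, i) \<in> simplex_of w \<longleftrightarrow> B \<in> faces w \<and> i = class_code w B"
  by (auto simp: simplex_of_def)

lemma is_simplex_simplex_of:
  assumes "finite Ag" "w \<in> W"
  shows "is_simplex Ag (simplex_of w)"
  unfolding simplex_of_def
proof (rule is_simplex_graph[OF assms(1)])
  show "faces w \<subseteq> Pow Ag"
    using assms(2) by (auto simp: faces_def world_pattern_eq)
next
  show "{} \<in> faces w" by (simp add: faces_def)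
next
  fix A B assume "A \<in> faces w" "B \<subseteq> A"
  then show "B \<in> faces w"
    using world_pattern_down[OF assms(2), of A B] by (auto simp: faces_def)
next
  fix A B assume "A \<in> faces w" "B \<in> faces w"
  then show "A \<union> B \<in> faces w"
    using world_pattern_Un[OF assms(2), of A B] by (auto simp: faces_def)
qed

lemma shared_face_imp_R:
  assumes "countable W" "w \<in> W" "v \<in> W" "B \<noteq> {}"
    and "(B, i) \<in> simplex_of w" "(B, i) \<in> simplex_of v"
  shows "(w, v) \<in> R {B}"
proof -
  have B: "agent_pattern Ag {B}" and refl: "(w, w) \<in> R {B}" "(v, v) \<in> R {B}"
    using assms by (auto simp: mem_simplex_of faces_def world_pattern_eq agent_pattern_def)
  \<comment> \<open>\<open>f\<close> picks the representative that \<open>class_code\<close>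
    numbers. As \<open>W\<close> is countable, \<open>to_nat_on W\<close> is injective on
    \<open>W\<close>, so equal indices mean a common representative, which links \<open>w\<close> to
    \<open>v\<close>.\<close>
  define f where "f x = (SOME u. u \<in> R {B} `` {x})" for x
  have f: "(w, f w) \<in> R {B}" "(v, f v) \<in> R {B}"
    using refl unfolding f_def by (metis Image_singleton_iff someI)+
  then have "f w \<in> W" "f v \<in> W" using R_sub[OF B] by auto
  moreover have "to_nat_on W (f w) = to_nat_on W (f v)"
    using assms by (simp add: mem_simplex_of class_code_def f_def)
  ultimately have "f w = f v" using assms(1) by simp
  with f show ?thesis using R_sym[OF B] R_trans[OF B] by (metis symE transE)
qed

lemma R_imp_shared_face:
  assumes "w \<in> W" "v \<in> W" "B \<subseteq> Ag" "B \<noteq> {}" "(w, v) \<in> R {B}"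
  shows "B \<in> faces w" "B \<in> faces v" "class_code w B = class_code v B"
proof -
  have B: "agent_pattern Ag {B}" using assms by (simp add: agent_pattern_def)
  note st = R_sym[OF B] R_trans[OF B]
  have "(w, w) \<in> R {B}" "(v, v) \<in> R {B}"
    using st assms(5) by (meson symE transE)+
  then show "B \<in> faces w" "B \<in> faces v"
    using assms by (auto simp: faces_def world_pattern_eq)
  \<comment> \<open>The chosen representative depends only on the class as a set.\<close>
  have "R {B} `` {w} = R {B} `` {v}"
    using st assms(5) unfolding sym_def trans_def by blast
  then show "class_code w B = class_code v B" by (simp add: class_code_def)
qed

text \<open>Both sides can be tested on one member of \<open>G\<close> at a time, the right one by
  (D); for empty \<open>G\<close> both hold.\<close>

lemma subset_degr_iff:
  assumes "countable W" "w \<in> W" "v \<in> W" "agent_pattern Ag G"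
  shows "G \<subseteq> degr (simplex_of w \<inter> simplex_of v) \<longleftrightarrow> (w, v) \<in> R G"
proof -
  have "B \<in> degr (simplex_of w \<inter> simplex_of v) \<longleftrightarrow> (w, v) \<in> R {B}" if "B \<in> G" for B
  proof -
    have B: "B \<subseteq> Ag" "B \<noteq> {}" using assms(4) that by (auto simp: agent_pattern_def)
    show ?thesis
    proof
      assume "B \<in> degr (simplex_of w \<inter> simplex_of v)"
      then obtain i where "(B, i) \<in> simplex_of w" "(B, i) \<in> simplex_of v"
        unfolding degr_def by blast
      then show "(w, v) \<in> R {B}" by (rule shared_face_imp_R[OF assms(1-3) B(2)])
    next
      assume "(w, v) \<in> R {B}"
      from R_imp_shared_face[OF assms(2,3) B this]
      have "(B, class_code w B) \<in> simplex_of w \<inter> simplex_of v"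
        by (simp add: mem_simplex_of)
      then show "B \<in> degr (simplex_of w \<inter> simplex_of v)"
        unfolding degr_def by blast
    qed
  qed
  then show ?thesis using R_iff[OF assms(4,2,3)] by auto
qed

text \<open>A vertex shared over a nonempty \<open>A\<close> relates the two worlds by
  \<open>R {A}\<close>, hence by \<open>R {B}\<close> for every nonempty subset \<open>B\<close>,
  where the indices therefore agree. Over the empty set every index is 0.\<close>

lemma is_complex_simplex_of:
  assumes "finite Ag" "countable W"
  shows "is_complex Ag (simplex_of ` W)"
proof -
  have sub: "(B, j) \<in> simplex_of v"
    if "w \<in> W" "v \<in> W" "(A, i) \<in> simplex_of w" "(A, i) \<in> simplex_of v" "B \<subseteq> A"
      "(B, j) \<in> simplex_of w" for w v A B i j
  proof (cases "B = {}")
    case True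
    with that show ?thesis by (auto simp: mem_simplex_of faces_def class_code_def)
  next
    case False
    then have "A \<noteq> {}" using that by auto
    then have "A \<subseteq> Ag" "(w, v) \<in> R {A}"
      using that shared_face_imp_R[OF assms(2)]
      by (auto simp: mem_simplex_of faces_def world_pattern_eq)
    then have "(w, v) \<in> R {B}" "B \<subseteq> Ag" using R_singleton_mono that False by blast+
    with R_imp_shared_face[of w v B] that False show ?thesis
      by (simp add: mem_simplex_of)
  qed
  show ?thesis
    unfolding is_complex_def
  proof (intro conjI ballI)
    fix S assume "S \<in> simplex_of ` W"
    then show "is_simplex Ag S" using is_simplex_simplex_of[OF assms(1)] by blast
  next
    fix S T x assume "S \<in> simplex_of ` W" "T \<in> simplex_of ` W" "x \<in> S \<inter> T"
    then obtain w v A i where wv: "w \<in> W" "v \<in> W" "S = simplex_of w" "T = simplex_of v" "x = (A, i)"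
      "(A, i) \<in> simplex_of w" "(A, i) \<in> simplex_of v"
      by (cases x) blast
    have "(B, j) \<in> S \<longleftrightarrow> (B, j) \<in> T" if "B \<subseteq> A" for B j
      unfolding wv(3,4)
      using sub[OF wv(1,2,6,7) that] sub[OF wv(2,1,7,6) that] by (rule iffI)
    then show "case x of (A, i) \<Rightarrow> \<forall>B \<subseteq> A. \<forall>j. (B, j) \<in> S \<longleftrightarrow> (B, j) \<in> T"
      unfolding wv(5) prod.case by (intro allI impI)
  qed
qed

lemma inj_on_simplex_of:
  assumes "countable W" "proper Ag W R"
  shows "inj_on simplex_of W"
proof (rule inj_onI)
  fix w v assume wv: "w \<in> W" "v \<in> W" and eq: "simplex_of w = simplex_of v"
  have wp: "world_pattern Ag W R x = degr (simplex_of x) - {{}}" if "x \<in> W" for x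
    using that by (auto simp: degr_def mem_simplex_of faces_def world_pattern_eq)
  then have "world_pattern Ag W R w = world_pattern Ag W R v"
    using wv eq by simp
  \<comment> \<open>The two simplices meet in all of \<open>simplex_of w\<close>, whose faces cover
    the pattern of \<open>w\<close>.\<close>
  moreover have "(w, v) \<in> R (world_pattern Ag W R w)"
    using subset_degr_iff[OF assms(1) wv agent_pattern_world_pattern, of w] wp[OF wv(1)] eq by auto
  ultimately show "w = v"
    using assms(2) wv by (simp add: proper_def world_equiv_def)
qed

end

theorem theorem5p59:
  fixes Ag :: "'a set" and Atoms :: "'p set" and W :: "'w set"
    and R :: "'a set set \<Rightarrow> ('w \<times> 'w) set" and V :: "'w \<Rightarrow> 'p set"
  assumes "finite Ag" and "countable Atoms" and "countable W"
    and "delta_model Ag Atoms W R V" and "proper Ag W R"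
  shows "\<exists>\<C> L. simplicial_model Ag Atoms \<C> L \<and> delta_translation Ag Atoms \<C> L W R V"
proof -
  interpret delta Ag Atoms W R V by unfold_locales (rule assms(4))
  define L where "L S = V (inv_into W simplex_of S)" for S
  have L: "L (simplex_of w) = V w" if "w \<in> W" for w
    using inj_on_simplex_of[OF assms(3,5)] that by (simp add: L_def)
  have "V \<in> W \<rightarrow> Pow Atoms"
    using assms(4) by (simp add: delta_model_def pre_model_def)
  then have "simplicial_model Ag Atoms (simplex_of ` W) L"
    unfolding simplicial_model_def using is_complex_simplex_of[OF assms(1,3)] L by auto
  moreover have "delta_translation Ag Atoms (simplex_of ` W) L W R V"
    unfolding delta_translation_def
    by (rule bexI[of _ simplex_of]) (use subset_degr_iff[OF assms(3)] L in auto)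
  ultimately show ?thesis by blast
qed

end
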